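(* There exists an absolute constant $C>0$ such that the following holds. Let $\varepsilon>0$, let $N$ be a positive integer with $N\geq\exp\exp(C\varepsilon^{-1}\log\varepsilon^{-1})$, and let $A\subseteq\{1,\dots,N\}$. Then there exists an integer $t\neq 0$ such that \[\frac{|A\cap(A+t^2)|}{N}>\left(\frac{|A|}{N}\right)^2-\varepsilon.\]
   Context: For a set $A$ of integers and an integer $m$, $A+m=\{a+m : a\in A\}$, and $|A|$ denotes the cardinality of $A$. *)

theory Defs
  imports Complex_Main
begin

definition translate :: "int set \<Rightarrow> int \<Rightarrow> int set" where
  "translate A m = {a + m | a. a \<in> A}"

end

theory Submission
  imports Defs "HOL-Analysis.Convex"
begin

text \<open>
  The idea is to find a probability measure on a finite set of positive integers \<open>t\<close>, not
  depending on \<open>A\<close>, such that the average of \<open>Re (z ^ t\<^sup>2)\<close> is at least \<open>- \<epsilon> / 2\<close> for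
  \<^emph>\<open>every\<close> complex number \<open>z\<close> of modulus 1. This is a quantitative form of the statement that the
  squares are a van der Corput set, and it implies the theorem (\<open>popular_difference_of_kernel\<close>):
  after embedding \<open>{1..N}\<close> in the integers modulo \<open>M = N + T\<^sup>2\<close>, where \<open>T\<close> bounds all \<open>t\<close>, the
  number \<open>M * |A \<inter> (A + t\<^sup>2)|\<close> is the sum of \<open>W z * Re (z ^ t\<^sup>2)\<close> over the \<open>M\<close>-th roots of
  unity \<open>z\<close>, with \<open>W z \<ge> 0\<close> the squared modulus of the Fourier transform of \<open>A\<close>. On averaging
  over \<open>t\<close>, the root \<open>z = 1\<close> contributes the main term \<open>|A|\<^sup>2\<close> and the other roots together
  contribute at least \<open>- (\<epsilon> / 2) * M * |A|\<close>. Since \<open>T\<^sup>2\<close> is small compared with \<open>\<epsilon> * N\<close>,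
  passing from \<open>N\<close> to \<open>M\<close> costs little.

  The measure is built from \<open>k\<close> scales of rapidly decreasing lengths \<open>L 0 > L 1 > ...\<close>. At scale
  \<open>i\<close> one takes \<open>t = D ^ i * (s + h)\<close> with \<open>s < L i\<close> and \<open>1 \<le> h \<le> H\<close>, where \<open>H\<close> is of order
  \<open>\<epsilon> powr -2\<close> and \<open>D = (2 * H)!\<close>. The short extra shift \<open>h\<close> allows a single Cauchy-Schwarz step
  (\<open>norm_square_sum_le\<close>) in place of Weyl's inequality: with \<open>w = z ^ (D ^ i)\<^sup>2\<close>, the average at
  scale \<open>i\<close> has modulus at most \<open>sqrt (2 / H)\<close> unless some power \<open>w ^ r\<close> with \<open>1 \<le> r \<le> 2 * H\<close> lies
  within \<open>2 * H / L i\<close> of 1. In this exceptional case \<open>r\<close> divides \<open>D\<close>, so at every later scale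
  \<open>j\<close> the numbers \<open>z ^ t\<^sup>2\<close> are powers of \<open>w ^ r\<close> with exponents at most \<open>L i / (2 * H)\<close>; they all
  lie within distance 1 of 1, hence in the right half-plane, and the average at scale \<open>j\<close> is
  nonnegative. So at most one scale is harmful, and as its average is at least \<open>-1\<close>, averaging over the \<open>k\<close> scales gives a lower bound
  \<open>- 1 / k - sqrt (2 / H)\<close> (\<open>square_kernel_ge\<close>).

  The exceptional case gives a distance of order \<open>1 / L i\<close>, while the exponents at a later scale are
  of order \<open>(L j)\<^sup>2\<close>. Thus each length must exceed the square of the next one, \<open>ln (L 0)\<close> is
  exponential in \<open>k\<close>, and \<open>k\<close> is of order \<open>1 / \<epsilon>\<close>: this is the source of the double exponential.
  The construction serves \<open>\<epsilon> \<le> 1 / 2\<close>; for larger \<open>\<epsilon>\<close> the choice \<open>t = 1\<close> works by counting.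
\<close>

section \<open>Quadratic exponential sums\<close>

lemma unimodular_power_cancel:
  fixes w :: complex
  assumes "norm w = 1"
  shows "w ^ (m + n) * cnj (w ^ m) = w ^ n"
proof -
  have "w ^ m * cnj (w ^ m) = 1"
    by (simp only: complex_norm_square[symmetric] norm_power assms) simp
  then show ?thesis
    by (simp add: power_add mult.assoc mult.left_commute)
qed

lemma norm_geometric_sum_le:
  fixes w :: complex
  assumes "norm w = 1" "w \<noteq> 1"
  shows "norm (\<Sum>s<L. w ^ s) \<le> 2 / norm (w - 1)"
proof -
  have "norm (w ^ L - 1) \<le> norm (w ^ L) + norm (1::complex)"
    by (rule norm_triangle_ineq4)
  then have "norm (w ^ L - 1) \<le> 2"
    using assms by (simp add: norm_power)
  then show ?thesis
    using assms by (simp add: geometric_sum norm_divide divide_right_mono)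
qed

text \<open>
  The difference of two shifted squares is linear in \<open>s\<close>, so the correlation is a geometric sum
  with ratio \<open>w ^ (2 * d)\<close>.
\<close>

lemma norm_shifted_square_correlation_le:
  fixes w :: complex
  assumes w: "norm w = 1" and r: "w ^ (2 * d) \<noteq> 1"
  shows "norm (\<Sum>s<L. w ^ (s + (h + d))\<^sup>2 * cnj (w ^ (s + h)\<^sup>2)) \<le> 2 / norm (w ^ (2 * d) - 1)"
proof -
  have "w ^ (s + (h + d))\<^sup>2 * cnj (w ^ (s + h)\<^sup>2) = w ^ (2 * d * h + d\<^sup>2) * (w ^ (2 * d)) ^ s" for s
  proof -
    have "(s + (h + d))\<^sup>2 = (s + h)\<^sup>2 + ((2 * d * h + d\<^sup>2) + 2 * d * s)"
      by (simp add: power2_eq_square algebra_simps)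
    then have "w ^ (s + (h + d))\<^sup>2 * cnj (w ^ (s + h)\<^sup>2) = w ^ ((2 * d * h + d\<^sup>2) + 2 * d * s)"
      by (simp only: unimodular_power_cancel[OF w])
    then show ?thesis
      by (simp only: power_add power_mult)
  qed
  then have "(\<Sum>s<L. w ^ (s + (h + d))\<^sup>2 * cnj (w ^ (s + h)\<^sup>2))
      = w ^ (2 * d * h + d\<^sup>2) * (\<Sum>s<L. (w ^ (2 * d)) ^ s)"
    by (simp add: sum_distrib_left)
  then show ?thesis
    using norm_geometric_sum_le[of "w ^ (2 * d)" L] w r by (simp add: norm_mult norm_power)
qed

text \<open>
  Cauchy-Schwarz over \<open>s\<close> reduces the double sum to the correlations between two shifts \<open>h\<close> and
  \<open>h'\<close>. The \<open>H\<close> diagonal ones are \<open>L\<close> each; the off-diagonal ones are at most \<open>L / H\<close> each,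
  because the geometric ratio is kept away from 1 by the hypothesis. The two contributions balance,
  and the saving over the trivial bound \<open>L\<^sup>2 * H\<^sup>2\<close> is a factor \<open>H / 2\<close>.
\<close>

lemma norm_square_sum_le:
  fixes w :: complex
  assumes w: "norm w = 1" and H: "H > 0" and L: "L > 0"
    and far: "\<And>r. r \<in> {1..2 * H} \<Longrightarrow> norm (w ^ r - 1) \<ge> 2 * real H / real L"
  shows "(norm (\<Sum>s<L. \<Sum>h=1..H. w ^ (s + h)\<^sup>2))\<^sup>2 \<le> 2 * (real L)\<^sup>2 * real H"
proof -
  define X where "X s = (\<Sum>h=1..H. w ^ (s + h)\<^sup>2)" for s
  define c where "c h h' = (\<Sum>s<L. w ^ (s + h)\<^sup>2 * cnj (w ^ (s + h')\<^sup>2))" for h h'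
  have lt: "norm (c (h + d) h) \<le> real L / real H" if d: "0 < d" "d \<le> H" for h d
  proof -
    have f: "norm (w ^ (2 * d) - 1) \<ge> 2 * real H / real L"
      using d by (intro far) auto
    moreover have pos: "2 * real H / real L > 0"
      using H L by simp
    ultimately have "norm (w ^ (2 * d) - 1) > 0" by linarith
    then have "norm (c (h + d) h) \<le> 2 / norm (w ^ (2 * d) - 1)"
      unfolding c_def by (intro norm_shifted_square_correlation_le w) auto
    also have "\<dots> \<le> 2 / (2 * real H / real L)"
      using f pos by (intro divide_left_mono mult_pos_pos) auto
    finally show ?thesis by simp
  qed
  have sym: "norm (c h h') = norm (c h' h)" for h h'
  proof -
    have "c h h' = cnj (c h' h)"
      by (simp add: c_def mult.commute)
    then show ?thesis by (metis complex_mod_cnj)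
  qed
  have diag: "norm (c h h) = real L" for h
    using unimodular_power_cancel[OF w, where n = 0] by (simp add: c_def)
  have off: "norm (c h h') \<le> real L / real H" if "h \<in> {1..H}" "h' \<in> {1..H}" "h \<noteq> h'" for h h'
  proof (cases "h' < h")
    case True
    then show ?thesis using lt[of "h - h'" h'] that by auto
  next
    case False
    then show ?thesis using lt[of "h' - h" h] that sym[of h h'] by auto
  qed
  have "norm (c h h') \<le> (if h = h' then real L else 0) + real L / real H"
    if "h \<in> {1..H}" "h' \<in> {1..H}" for h h'
    using off[OF that] diag[of h] by auto
  then have csum: "(\<Sum>h=1..H. \<Sum>h'=1..H. norm (c h h'))
      \<le> (\<Sum>h=1..H. \<Sum>h'=1..H. (if h = h' then real L else 0) + real L / real H)"
    by (intro sum_mono)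
  also have "\<dots> = 2 * real L * real H"
    using H by (simp add: sum.distrib)
  finally have csum: "(\<Sum>h=1..H. \<Sum>h'=1..H. norm (c h h')) \<le> 2 * real L * real H" .
  have "complex_of_real (\<Sum>s<L. (norm (X s))\<^sup>2) = (\<Sum>s<L. X s * cnj (X s))"
    by (simp only: of_real_sum complex_norm_square)
  also have "\<dots> = (\<Sum>s<L. \<Sum>h=1..H. \<Sum>h'=1..H. w ^ (s + h)\<^sup>2 * cnj (w ^ (s + h')\<^sup>2))"
    by (simp only: X_def cnj_sum sum_product)
  also have "\<dots> = (\<Sum>h=1..H. \<Sum>s<L. \<Sum>h'=1..H. w ^ (s + h)\<^sup>2 * cnj (w ^ (s + h')\<^sup>2))"
    by (rule sum.swap)
  also have "\<dots> = (\<Sum>h=1..H. \<Sum>h'=1..H. c h h')"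
    unfolding c_def by (intro sum.cong refl sum.swap)
  finally have "norm (complex_of_real (\<Sum>s<L. (norm (X s))\<^sup>2)) = norm (\<Sum>h=1..H. \<Sum>h'=1..H. c h h')"
    by simp
  then have "(\<Sum>s<L. (norm (X s))\<^sup>2) = norm (\<Sum>h=1..H. \<Sum>h'=1..H. c h h')"
    by (simp only: norm_of_real) (simp add: sum_nonneg)
  also have "\<dots> \<le> (\<Sum>h=1..H. \<Sum>h'=1..H. norm (c h h'))"
    by (intro order_trans[OF norm_sum] sum_mono norm_sum)
  finally have X2: "(\<Sum>s<L. (norm (X s))\<^sup>2) \<le> 2 * real L * real H"
    using csum by linarith
  \<comment> \<open>Cauchy-Schwarz over \<open>s\<close>.\<close>
  have "(norm (\<Sum>s<L. X s))\<^sup>2 \<le> (\<Sum>s<L. norm (X s))\<^sup>2"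
    by (intro power_mono norm_sum) auto
  also have "\<dots> \<le> (\<Sum>s<L. (norm (X s))\<^sup>2) * real (card {..<L})"
    by (rule sum_squared_le_sum_of_squares) 
  also have "\<dots> \<le> (2 * real L * real H) * real L"
    using X2 by (simp add: mult_right_mono)
  finally show ?thesis
    by (simp add: X_def power2_eq_square algebra_simps)
qed

section \<open>A kernel on squares with almost nonnegative transform\<close>

text \<open>
  At most one index is harmful: once \<open>S i < - \<delta>\<close> has occurred, all later terms are nonnegative.
\<close>

lemma sum_ge_of_one_bad_index:
  fixes S :: "nat \<Rightarrow> real"
  assumes "\<And>i. i < k \<Longrightarrow> S i \<ge> -1"
    and "\<And>i j. i < j \<Longrightarrow> j < k \<Longrightarrow> S i < -\<delta> \<Longrightarrow> S j \<ge> 0"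
    and "\<delta> \<ge> 0"
  shows "(\<Sum>i<k. S i) \<ge> -1 - real k * \<delta>"
  using assms
proof (induction k)
  case 0
  then show ?case by simp
next
  case (Suc k)
  show ?case
  proof (cases "\<exists>i<k. S i < -\<delta>")
    case True
    then have "S k \<ge> 0" using Suc.prems(2) by blast
    moreover have "(\<Sum>i<k. S i) \<ge> -1 - real k * \<delta>"
      using Suc.prems by (intro Suc.IH) auto
    ultimately show ?thesis using \<open>\<delta> \<ge> 0\<close> by (simp add: algebra_simps)
  next
    case False
    then have "S i \<ge> -\<delta>" if "i < k" for i
      using that by (meson not_less)
    then have "(\<Sum>i<k. -\<delta>) \<le> (\<Sum>i<k. S i)"
      by (intro sum_mono) simp
    moreover have "S k \<ge> -1" using Suc.prems(1) by blast
    ultimately show ?thesis using \<open>\<delta> \<ge> 0\<close> by (simp add: algebra_simps)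
  qed
qed

text \<open>
  The dichotomy between scales. A scale \<open>i\<close> with noticeably negative average forces \<open>w ^ r\<close> to be
  near 1 for some \<open>r\<close> dividing \<open>D\<close>, where \<open>w = z ^ (D ^ i)\<^sup>2\<close>. All exponents occurring at later
  scales are multiples of \<open>(D ^ i)\<^sup>2 * r\<close>, and \<open>sparse\<close> says that the cofactors are too small to
  carry \<open>w ^ r\<close> further than distance 1 from 1, hence not out of the right half-plane.
\<close>

lemma square_kernel_ge:
  fixes z :: complex and L :: "nat \<Rightarrow> nat" and H k :: nat
  defines "D \<equiv> fact (2 * H) :: nat"
  defines "S \<equiv> \<lambda>i. (\<Sum>s<L i. \<Sum>h=1..H. Re (z ^ (D ^ i * (s + h))\<^sup>2)) / (real (L i) * real H)"
  assumes z: "norm z = 1" and H: "H > 0"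
    and L: "\<And>i. i < k \<Longrightarrow> L i > 0"
    and sparse: "\<And>i j. i < j \<Longrightarrow> j < k \<Longrightarrow> 2 * H * D ^ (2 * k) * (L j + H)\<^sup>2 \<le> L i"
  shows "(\<Sum>i<k. S i) \<ge> -1 - real k * sqrt (2 / real H)"
proof (rule sum_ge_of_one_bad_index)
  fix i assume i: "i < k"
  have "Re (z ^ n) \<ge> -1" for n
    using abs_Re_le_cmod[of "z ^ n"] z by (simp add: norm_power)
  then have "(\<Sum>s<L i. \<Sum>h=1..H. -1) \<le> (\<Sum>s<L i. \<Sum>h=1..H. Re (z ^ (D ^ i * (s + h))\<^sup>2))"
    by (intro sum_mono)
  then show "S i \<ge> -1"
    using H L[OF i] by (simp add: S_def field_simps)
next
  fix i j assume ij: "i < j" "j < k" and neg: "S i < - sqrt (2 / real H)"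
  define w where "w = z ^ (D ^ i)\<^sup>2"
  have w: "norm w = 1" using z by (simp add: w_def norm_power)
  have pos: "real (L i) > 0" using L ij by simp
  have S_w: "S i = Re (\<Sum>s<L i. \<Sum>h=1..H. w ^ (s + h)\<^sup>2) / (real (L i) * real H)"
    by (simp add: S_def w_def power_mult_distrib flip: power_mult)
  \<comment> \<open>Otherwise the exponential sum bound would contradict \<open>neg\<close>.\<close>
  have "\<exists>r\<in>{1..2 * H}. norm (w ^ r - 1) < 2 * real H / real (L i)"
  proof (rule ccontr)
    assume "\<not> ?thesis"
    then have "(norm (\<Sum>s<L i. \<Sum>h=1..H. w ^ (s + h)\<^sup>2))\<^sup>2 \<le> 2 * (real (L i))\<^sup>2 * real H"
      using pos by (intro norm_square_sum_le w H) (auto simp: not_less)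
    also have "\<dots> = (sqrt (2 / real H) * (real (L i) * real H))\<^sup>2"
      using H by (simp add: power_mult_distrib) (simp add: power2_eq_square)
    finally have "norm (\<Sum>s<L i. \<Sum>h=1..H. w ^ (s + h)\<^sup>2) \<le> sqrt (2 / real H) * (real (L i) * real H)"
      by (rule power2_le_imp_le) simp
    then have "- Re (\<Sum>s<L i. \<Sum>h=1..H. w ^ (s + h)\<^sup>2) \<le> sqrt (2 / real H) * (real (L i) * real H)"
      using abs_Re_le_cmod[of "\<Sum>s<L i. \<Sum>h=1..H. w ^ (s + h)\<^sup>2"] by linarith
    then have "S i \<ge> - sqrt (2 / real H)"
      using pos H unfolding S_w by (simp add: pos_le_divide_eq)
    then show False using neg by simp
  qed
  then obtain r where r: "r \<in> {1..2 * H}" and near: "norm (w ^ r - 1) < 2 * real H / real (L i)"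
    by blast
  have "r dvd D" using r unfolding D_def by (intro dvd_fact) auto
  moreover have "D dvd (D ^ (j - i))\<^sup>2"
    using ij by (simp add: dvd_power flip: power_mult)
  ultimately obtain m where m: "(D ^ (j - i))\<^sup>2 = r * m"
    by (meson dvd_trans dvdE)
  have "m \<le> r * m" using r by simp
  also have "\<dots> = D ^ (2 * (j - i))"
    by (simp only: m[symmetric]) (simp add: mult.commute flip: power_mult)
  also have "\<dots> \<le> D ^ (2 * k)"
    using ij by (intro power_increasing) (auto simp: D_def)
  finally have m_le: "m \<le> D ^ (2 * k)" .
  have term_ge_0: "Re (z ^ (D ^ j * (s + h))\<^sup>2) \<ge> 0" if sh: "s < L j" "h \<in> {1..H}" for s h
  proof -
    have "D ^ j = D ^ i * D ^ (j - i)" using ij by (simp flip: power_add)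
    then have "(D ^ j * (s + h))\<^sup>2 = (D ^ i)\<^sup>2 * ((D ^ (j - i))\<^sup>2 * (s + h)\<^sup>2)"
      by (simp only: power_mult_distrib mult.assoc)
    also have "\<dots> = (D ^ i)\<^sup>2 * (r * (m * (s + h)\<^sup>2))"
      by (simp add: m)
    finally have e: "z ^ (D ^ j * (s + h))\<^sup>2 = (w ^ r) ^ (m * (s + h)\<^sup>2)"
      by (simp only: w_def power_mult)
    have "norm ((w ^ r) ^ (m * (s + h)\<^sup>2) - 1 ^ (m * (s + h)\<^sup>2)) \<le> real (m * (s + h)\<^sup>2) * norm (w ^ r - 1)"
      using w by (intro norm_power_diff) (simp_all add: norm_power)
    also have "\<dots> \<le> real (D ^ (2 * k) * (L j + H)\<^sup>2) * (2 * real H / real (L i))"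
      using near m_le sh
      by (intro mult_mono of_nat_mono mult_le_mono power_mono) auto
    also have "\<dots> = real (2 * H * D ^ (2 * k) * (L j + H)\<^sup>2) / real (L i)"
      by simp
    also have "\<dots> \<le> real (L i) / real (L i)"
      using sparse[OF ij] by (intro divide_right_mono of_nat_mono) auto
    finally have "norm (z ^ (D ^ j * (s + h))\<^sup>2 - 1) \<le> 1"
      using pos by (simp add: e)
    then show ?thesis
      using abs_Re_le_cmod[of "z ^ (D ^ j * (s + h))\<^sup>2 - 1"] by simp
  qed
  show "S j \<ge> 0"
    unfolding S_def using term_ge_0 by (intro divide_nonneg_nonneg sum_nonneg) auto
qed simp

section \<open>From kernels to popular differences\<close>

lemma sum_roots_of_unity_powi:
  fixes d :: int
  assumes "\<bar>d\<bar> < int M"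
  shows "(\<Sum>x<M. (cis (2 * pi / M) ^ x) powi d) = (if d = 0 then of_nat M else 0)"
proof (cases "d = 0")
  case False
  define u where "u = cis (2 * pi * d / M)"
  have M: "M > 0" using assms by auto
  have "(cis (2 * pi / M) ^ x) powi d = u ^ x" for x
    by (simp add: u_def cis_power_int DeMoivre mult_ac)
  moreover have "u ^ M = 1"
    using M by (simp add: u_def DeMoivre cis_multiple_2pi)
  moreover have "u \<noteq> 1"
  proof
    assume "u = 1"
    then have "cos (2 * pi * d / M) = 1"
      by (simp add: u_def complex_eq_iff)
    then obtain n :: int where "2 * pi * d / M = real_of_int n * 2 * pi"
      by (auto simp: cos_one_2pi_int)
    then have "real_of_int d = real_of_int (n * int M)"
      using M by (simp add: field_simps)
    then have "d = n * int M" by linarith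
    then show False using assms False dvd_imp_le_int[of d "int M"] by auto
  qed
  ultimately show ?thesis using False by (simp add: geometric_sum)
qed auto

text \<open>
  Orthogonality modulo \<open>M\<close> only detects \<open>a - b + n\<close> being divisible by \<open>M\<close>. The condition
  \<open>n + N \<le> M\<close> prevents wrap-around, so that this means \<open>a = b - n\<close>.
\<close>

lemma card_translate_fourier:
  fixes A :: "int set"
  assumes A: "A \<subseteq> {1..int N}" and M: "n + N \<le> M"
  shows "real M * real (card (A \<inter> translate A (int n)))
    = (\<Sum>x<M. (norm (\<Sum>a\<in>A. (cis (2 * pi / M) ^ x) powi a))\<^sup>2 * Re ((cis (2 * pi / M) ^ x) ^ n))"
proof -
  define v where "v x = cis (2 * pi / M) ^ x" for x
  have fin: "finite A" using A finite_subset by auto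
  have v: "norm (v x) = 1" "v x \<noteq> 0" for x by (simp_all add: v_def norm_power)
  have cnj: "cnj (v x powi b) = v x powi (- b)" for x b
    by (simp add: v_def DeMoivre cis_power_int cis_cnj)
  have sq: "of_real ((norm (\<Sum>a\<in>A. v x powi a))\<^sup>2) * v x ^ n
      = (\<Sum>b\<in>A. \<Sum>a\<in>A. v x powi (a - b + int n))" for x
  proof -
    have "of_real ((norm (\<Sum>a\<in>A. v x powi a))\<^sup>2) = (\<Sum>a\<in>A. \<Sum>b\<in>A. v x powi a * v x powi (- b))"
      by (simp only: complex_norm_square cnj_sum cnj sum_product)
    also have "\<dots> = (\<Sum>b\<in>A. \<Sum>a\<in>A. v x powi a * v x powi (- b))"
      by (rule sum.swap)
    finally have *: "of_real ((norm (\<Sum>a\<in>A. v x powi a))\<^sup>2) = (\<Sum>b\<in>A. \<Sum>a\<in>A. v x powi a * v x powi (- b))" .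
    have "v x powi a * v x powi (- b) * v x ^ n = v x powi (a - b + int n)" for a b
    proof -
      have "v x powi (a - b + int n) = v x powi (a + (- b) + int n)" by simp
      also have "\<dots> = v x powi a * v x powi (- b) * v x powi int n"
        using v(2) by (simp only: power_int_add simp_thms)
      finally show ?thesis by simp
    qed
    then show ?thesis by (simp only: * sum_distrib_right)
  qed
  have "(\<Sum>x<M. of_real ((norm (\<Sum>a\<in>A. v x powi a))\<^sup>2) * v x ^ n)
      = (\<Sum>x<M. \<Sum>b\<in>A. \<Sum>a\<in>A. v x powi (a - b + int n))"
    by (simp only: sq)
  also have "\<dots> = (\<Sum>b\<in>A. \<Sum>x<M. \<Sum>a\<in>A. v x powi (a - b + int n))"
    by (rule sum.swap)
  also have "\<dots> = (\<Sum>b\<in>A. \<Sum>a\<in>A. \<Sum>x<M. v x powi (a - b + int n))"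
    by (intro sum.cong refl sum.swap)
  also have "\<dots> = (\<Sum>b\<in>A. \<Sum>a\<in>A. if a = b - int n then of_nat M else 0)"
  proof (intro sum.cong refl)
    fix a b assume "a \<in> A" "b \<in> A"
    then have "1 \<le> a" "a \<le> int N" "1 \<le> b" "b \<le> int N" using A by auto
    then have "\<bar>a - b + int n\<bar> < int M" using M by linarith
    then show "(\<Sum>x<M. v x powi (a - b + int n)) = (if a = b - int n then of_nat M else 0)"
      unfolding v_def by (subst sum_roots_of_unity_powi) auto
  qed
  also have "\<dots> = (\<Sum>b\<in>A. if b - int n \<in> A then of_nat M else 0)"
    using fin by simp
  also have "\<dots> = (\<Sum>b\<in>{b\<in>A. b - int n \<in> A}. of_nat M)"
    using fin by (rule sum.inter_filter[symmetric])
  also have "{b\<in>A. b - int n \<in> A} = A \<inter> translate A (int n)"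
    by (force simp: translate_def)
  finally have "Re (\<Sum>x<M. of_real ((norm (\<Sum>a\<in>A. v x powi a))\<^sup>2) * v x ^ n)
      = Re (of_nat (card (A \<inter> translate A (int n)) * M))"
    by simp
  then show ?thesis by (simp add: v_def mult.commute)
qed

text \<open>
  The van der Corput principle. The weighted average over \<open>j\<close> of the Fourier expansions of
  \<open>|A \<inter> (A + n j)|\<close> has nonnegative coefficients \<open>W\<close> with total mass \<open>M * |A|\<close>; the trivial
  character has coefficient \<open>|A|\<^sup>2\<close> and the kernel bound controls all others. Some \<open>j\<close> does at
  least as well as the average.
\<close>

lemma popular_difference_of_kernel:
  fixes A :: "int set" and c :: "'j \<Rightarrow> real" and n :: "'j \<Rightarrow> nat"
  assumes A: "A \<subseteq> {1..int N}" and N: "N > 0"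
    and J: "finite J" and c: "\<And>j. j \<in> J \<Longrightarrow> c j \<ge> 0" "(\<Sum>j\<in>J. c j) = 1"
    and n: "\<And>j. j \<in> J \<Longrightarrow> n j \<le> m"
    and kernel: "\<And>z::complex. norm z = 1 \<Longrightarrow> (\<Sum>j\<in>J. c j * Re (z ^ n j)) \<ge> - \<eta>"
    and \<eta>: "\<eta> \<ge> 0"
  shows "\<exists>j\<in>J. real (card (A \<inter> translate A (int (n j))))
    \<ge> (real (card A))\<^sup>2 / real (N + m) - \<eta> * real (card A)"
proof (rule ccontr)
  define M where "M = N + m"
  define E where "E j = real (card (A \<inter> translate A (int (n j))))" for j
  define V where "V = (real (card A))\<^sup>2 / real M - \<eta> * real (card A)"
  define z where "z x = cis (2 * pi / M) ^ x" for x
  define W where "W x = (norm (\<Sum>a\<in>A. z x powi a))\<^sup>2" for x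
  assume "\<not> ?thesis"
  then have less: "E j < V" if "j \<in> J" for j
    using that by (auto simp: E_def V_def M_def not_le)
  have M: "M > 0" using N by (simp add: M_def)
  obtain j0 where j0: "j0 \<in> J" "c j0 > 0"
    using c by (metis less_eq_real_def sum.neutral zero_neq_one)
  have "(\<Sum>j\<in>J. c j * E j) < (\<Sum>j\<in>J. c j * V)"
  proof (rule sum_strict_mono_ex1[OF J])
    show "\<forall>j\<in>J. c j * E j \<le> c j * V"
      using less c by (simp add: mult_left_mono less_imp_le)
    show "\<exists>j\<in>J. c j * E j < c j * V"
      using less[OF j0(1)] j0 by (intro bexI[of _ j0]) auto
  qed
  also have "\<dots> = V" using c by (simp flip: sum_distrib_right)
  finally have avg: "(\<Sum>j\<in>J. c j * E j) < V" .
  have WM: "real M * E j = (\<Sum>x<M. W x * Re (z x ^ n j))" if "j \<in> J" for j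
    unfolding E_def W_def z_def using A n[OF that] by (intro card_translate_fourier) (auto simp: M_def)
  \<comment> \<open>The expansion at shift 0 is Parseval's identity.\<close>
  have "real M * real (card (A \<inter> translate A (int 0))) = (\<Sum>x<M. W x * Re (z x ^ 0))"
    unfolding W_def z_def using A by (intro card_translate_fourier) (auto simp: M_def)
  then have parseval: "(\<Sum>x<M. W x) = real M * real (card A)"
    by (simp add: translate_def)
  define K where "K x = (\<Sum>j\<in>J. c j * Re (z x ^ n j))" for x
  have K: "K x \<ge> - \<eta>" for x
    unfolding K_def by (intro kernel) (simp add: z_def norm_power)
  have W0: "W 0 = (real (card A))\<^sup>2" and K0: "K 0 = 1"
    by (simp_all add: W_def K_def z_def c)
  have split: "{..<M} = insert 0 {1..<M}" using M by auto
  have "real M * (\<Sum>j\<in>J. c j * E j) = (\<Sum>j\<in>J. c j * (\<Sum>x<M. W x * Re (z x ^ n j)))"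
    by (simp add: sum_distrib_left mult.left_commute flip: WM)
  also have "\<dots> = (\<Sum>j\<in>J. \<Sum>x<M. W x * (c j * Re (z x ^ n j)))"
    by (simp add: sum_distrib_left mult.left_commute)
  also have "\<dots> = (\<Sum>x<M. \<Sum>j\<in>J. W x * (c j * Re (z x ^ n j)))"
    by (rule sum.swap)
  also have "\<dots> = (\<Sum>x<M. W x * K x)"
    by (simp add: K_def sum_distrib_left)
  also have "\<dots> = W 0 + (\<Sum>x=1..<M. W x * K x)"
    by (simp add: split K0)
  finally have eq: "real M * (\<Sum>j\<in>J. c j * E j) = W 0 + (\<Sum>x=1..<M. W x * K x)" .
  have ge: "(\<Sum>x=1..<M. W x * - \<eta>) \<le> (\<Sum>x=1..<M. W x * K x)"
    using K by (intro sum_mono mult_left_mono) (auto simp: W_def)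
  have "(\<Sum>x=1..<M. W x * - \<eta>) = - \<eta> * ((\<Sum>x<M. W x) - W 0)"
    by (simp add: split sum_negf mult.commute flip: sum_distrib_left)
  then have "real M * (\<Sum>j\<in>J. c j * E j) \<ge> (1 + \<eta>) * W 0 - \<eta> * (real M * real (card A))"
    using eq ge by (simp add: parseval algebra_simps)
  moreover have "(1 + \<eta>) * W 0 \<ge> (real (card A))\<^sup>2"
    using \<eta> by (simp add: W0 algebra_simps)
  moreover have "real M * V = (real (card A))\<^sup>2 - \<eta> * (real M * real (card A))"
    using M by (simp add: V_def field_simps)
  ultimately have "real M * (\<Sum>j\<in>J. c j * E j) \<ge> real M * V" by linarith
  then show False using avg M by simp
qed

text \<open>
  Each length is the cube of the next one, which leaves one factor \<open>B \<le> L j\<close> to absorb the constants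
  in the condition that \<open>L i\<close> dominates \<open>(L j)\<^sup>2\<close>.
\<close>

lemma popular_square_difference:
  fixes A :: "int set" and H k N :: nat
  defines "B \<equiv> 8 * H * fact (2 * H) ^ (2 * k)"
  defines "T \<equiv> B ^ (3 ^ k + 2)"
  assumes A: "A \<subseteq> {1..int N}" and N: "N > 0" and H: "H > 0" and k: "k > 0"
  shows "\<exists>t::int. t \<noteq> 0 \<and> real (card (A \<inter> translate A (t\<^sup>2)))
    \<ge> (real (card A))\<^sup>2 / real (N + T\<^sup>2) - (1 / real k + sqrt (2 / real H)) * real (card A)"
proof -
  define D :: nat where "D = fact (2 * H)"
  define L where "L j = B ^ (3 ^ (k - j))" for j
  \<comment> \<open>Uniform weight on the scales \<open>i\<close>, then on the pairs \<open>(s, h)\<close> within a scale.\<close>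
  define J where "J = (SIGMA i:{..<k}. {..<L i} \<times> {1..H})"
  define c where "c = (\<lambda>(i, s :: nat, h :: nat). 1 / (real k * real (L i) * real H))"
  define t where "t = (\<lambda>(i, s, h). D ^ i * (s + h))"
  have D: "D \<ge> 1" unfolding D_def by simp
  have B: "B = 8 * H * D ^ (2 * k)" by (simp add: B_def D_def)
  have HB: "8 * H \<le> B" and DB: "D ^ (2 * k) \<le> B"
    using D H by (simp_all add: B)
  then have B1: "B \<ge> 1" using H by linarith
  have BL: "B \<le> L j" for j
    unfolding L_def using B1 by (intro self_le_power) auto
  have Lpos: "L j > 0" for j using BL[of j] B1 by linarith
  have sparse: "2 * H * D ^ (2 * k) * (L j + H)\<^sup>2 \<le> L i" if ij: "i < j" "j < k" for i j
  proof -
    have "L j + H \<le> 2 * L j" using BL[of j] HB by linarith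
    then have "2 * H * D ^ (2 * k) * (L j + H)\<^sup>2 \<le> 2 * H * D ^ (2 * k) * (2 * L j)\<^sup>2"
      by (intro mult_left_mono power_mono) auto
    also have "\<dots> = B * (L j)\<^sup>2" by (simp add: B power2_eq_square)
    also have "\<dots> = B ^ (1 + 2 * 3 ^ (k - j))"
      by (simp add: L_def mult.commute flip: power_mult)
    also have "\<dots> \<le> B ^ (3 ^ (k - i))"
    proof (rule power_increasing[OF _ B1])
      have "1 + 2 * 3 ^ (k - j) \<le> (3::nat) ^ Suc (k - j)" by simp
      also have "\<dots> \<le> 3 ^ (k - i)" using ij by (intro power_increasing) auto
      finally show "1 + 2 * 3 ^ (k - j) \<le> (3::nat) ^ (k - i)" .
    qed
    finally show ?thesis by (simp add: L_def)
  qed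
  have sum_J: "(\<Sum>j\<in>J. f j) = (\<Sum>i<k. \<Sum>s<L i. \<Sum>h=1..H. f (i, s, h))" for f :: "_ \<Rightarrow> real"
    by (simp add: J_def sum.Sigma sum.cartesian_product)
  have t_le: "t j \<le> T" and t_pos: "t j > 0" if jJ: "j \<in> J" for j
  proof -
    obtain i s h where j: "j = (i, s, h)" "i < k" "s < L i" "1 \<le> h" "h \<le> H"
      using jJ by (auto simp: J_def)
    have "L i \<le> L 0" unfolding L_def using B1 by (intro power_increasing) auto
    then have "s + h \<le> 2 * L 0" using j BL[of 0] HB by linarith
    also have "\<dots> \<le> B * L 0" using HB H by (intro mult_right_mono) auto
    finally have sh: "s + h \<le> B * L 0" .
    have "D ^ i \<le> D ^ (2 * k)" using D j by (intro power_increasing) auto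
    then have "D ^ i \<le> B" using DB by linarith
    then have "t j \<le> B * (B * L 0)" using sh by (simp only: j t_def prod.case mult_le_mono)
    then show "t j \<le> T" by (simp add: T_def L_def power_add power2_eq_square mult_ac)
    show "t j > 0" using j D by (simp add: t_def)
  qed
  have "\<exists>j\<in>J. real (card (A \<inter> translate A (int ((t j)\<^sup>2))))
    \<ge> (real (card A))\<^sup>2 / real (N + T\<^sup>2) - (1 / real k + sqrt (2 / real H)) * real (card A)"
  proof (rule popular_difference_of_kernel[where c = c and n = "\<lambda>j. (t j)\<^sup>2", OF A N])
    show "finite J" by (simp add: J_def)
    show "c j \<ge> 0" for j by (simp add: c_def split: prod.split)
    show "(\<Sum>j\<in>J. c j) = 1"
      using Lpos H k by (simp add: sum_J c_def)
    show "(t j)\<^sup>2 \<le> T\<^sup>2" if "j \<in> J" for j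
      using t_le[OF that] by (rule power_mono) simp
    show "0 \<le> 1 / real k + sqrt (2 / real H)" by simp
    fix z :: complex assume z: "norm z = 1"
    have "-1 - real k * sqrt (2 / real H)
      \<le> (\<Sum>i<k. (\<Sum>s<L i. \<Sum>h=1..H. Re (z ^ (D ^ i * (s + h))\<^sup>2)) / (real (L i) * real H))"
      unfolding D_def using z H Lpos sparse[unfolded D_def] by (rule square_kernel_ge)
    then have "(-1 - real k * sqrt (2 / real H)) / real k
      \<le> (\<Sum>i<k. (\<Sum>s<L i. \<Sum>h=1..H. Re (z ^ (D ^ i * (s + h))\<^sup>2)) / (real (L i) * real H)) / real k"
      by (rule divide_right_mono) simp
    also have "\<dots> = (\<Sum>j\<in>J. c j * Re (z ^ (t j)\<^sup>2))"
      by (simp add: sum_J c_def t_def sum_divide_distrib mult_ac)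
    also have "(-1 - real k * sqrt (2 / real H)) / real k = - (1 / real k + sqrt (2 / real H))"
      using k by (simp add: field_simps)
    finally show "- (1 / real k + sqrt (2 / real H)) \<le> (\<Sum>j\<in>J. c j * Re (z ^ (t j)\<^sup>2))" .
  qed
  then obtain j where j: "j \<in> J" "real (card (A \<inter> translate A (int ((t j)\<^sup>2))))
    \<ge> (real (card A))\<^sup>2 / real (N + T\<^sup>2) - (1 / real k + sqrt (2 / real H)) * real (card A)" ..
  then show ?thesis
    using t_pos[OF j(1)] by (intro exI[of _ "int (t j)"]) simp
qed

section \<open>Size of the parameters\<close>

lemma ln_shift_bound_less:
  fixes H k :: nat
  assumes H: "H > 0" and k: "k > 0"
  shows "ln (real (8 * H * fact (2 * H) ^ (2 * k))) < 16 * real k * (real H)\<^sup>2"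
proof -
  have "ln (fact (2 * H) :: real) \<le> ln (real (2 * H) ^ (2 * H))"
    using fact_le_power[of "2 * H", where 'a = real] H by (simp add: ln_le_cancel_iff)
  also have "\<dots> = real (2 * H) * ln (real (2 * H))"
    using H by (subst ln_realpow) auto
  also have "\<dots> \<le> real (2 * H) * real (2 * H)"
    using H ln_bound[of "real (2 * H)"] by (intro mult_left_mono) auto
  finally have f: "ln (fact (2 * H) :: real) \<le> 4 * (real H)\<^sup>2"
    by (simp add: power2_eq_square)
  have "ln (real (8 * H * fact (2 * H) ^ (2 * k))) = ln (8 * real H) + real (2 * k) * ln (fact (2 * H))"
    using H by (simp add: ln_mult ln_realpow)
  also have "\<dots> < 8 * real H + real (2 * k) * (4 * (real H)\<^sup>2)"
    using f H ln_less_self[of "8 * real H"] by (intro add_less_le_mono mult_left_mono) auto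
  also have "8 * real H \<le> 8 * (real k * (real H)\<^sup>2)"
  proof -
    have "H * 1 \<le> (H * H) * k" using H k by (intro mult_le_mono) auto
    then have "real (H * 1) \<le> real ((H * H) * k)" by (rule of_nat_mono)
    then show ?thesis by (simp add: power2_eq_square mult_ac)
  qed
  finally show ?thesis by (simp add: algebra_simps)
qed

text \<open>
  Here \<open>x\<close> stands for \<open>1 / \<epsilon>\<close>. The factor \<open>3 ^ (k + 2)\<close> with \<open>k\<close> about \<open>4 * x\<close> costs \<open>exp (12 * x * ln x)\<close>
  because \<open>3 \<le> x\<^sup>2\<close>; the remaining polynomial factors in \<open>x\<close> are absorbed in
  \<open>x ^ 22 \<le> exp (11 * x * ln x)\<close>. This yields the constant \<open>23 = 12 + 11\<close>.
\<close>

lemma shift_bound_less_exp_exp: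
  fixes x :: real and H k :: nat
  defines "B \<equiv> 8 * H * fact (2 * H) ^ (2 * k)"
  assumes x: "x \<ge> 2" and H: "32 * x\<^sup>2 \<le> H" "H \<le> 33 * x\<^sup>2" and k: "4 * x \<le> k" "k \<le> 4 * x + 1"
  shows "2 * x * (real (B ^ (3 ^ k + 2)))\<^sup>2 < exp (exp (23 * x * ln x))"
proof -
  have k0: "k > 0" and H0: "H > 0" using x H k by (auto intro: Nat.gr0I)
  have "x * 1 \<le> x * x" using x by (intro mult_left_mono) auto
  then have "x \<le> x\<^sup>2" by (simp add: power2_eq_square)
  then have "2 * x \<le> real H" using H(1) x by linarith
  also have "real H \<le> real B"
  proof -
    have "H * 1 \<le> (8 * H) * fact (2 * H) ^ (2 * k)" by (intro mult_le_mono) auto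
    then have "H \<le> B" by (simp add: B_def)
    then show ?thesis by simp
  qed
  finally have xB: "2 * x \<le> real B" .
  then have B: "real B > 1" using x by linarith
  have "2 * x * (real (B ^ (3 ^ k + 2)))\<^sup>2 \<le> real B * (real (B ^ (3 ^ k + 2)))\<^sup>2"
    using xB by (rule mult_right_mono) simp
  also have "\<dots> = real B ^ (2 * 3 ^ k + 5)"
  proof -
    have "2 * 3 ^ k + 5 = Suc ((3 ^ k + 2) * 2)" by simp
    then show ?thesis by (simp only: power_Suc power_mult of_nat_power)
  qed
  also have "\<dots> \<le> real B ^ (3 ^ (k + 2))"
  proof (rule power_increasing)
    have "(3::nat) ^ k \<ge> 1" by simp
    moreover have "(3::nat) ^ (k + 2) = 9 * 3 ^ k" by simp
    ultimately show "2 * 3 ^ k + 5 \<le> (3::nat) ^ (k + 2)" by linarith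
  qed (use B in simp)
  also have "\<dots> = exp (3 ^ (k + 2) * ln (real B))"
    using B exp_of_nat_mult[of "3 ^ (k + 2)" "ln (real B)"] by simp
  also have "\<dots> < exp (exp (23 * x * ln x))"
  proof -
    have "3 ^ (k + 2) * ln (real B) < 3 ^ (k + 2) * (16 * real k * (real H)\<^sup>2)"
      using ln_shift_bound_less[OF H0 k0] by (simp add: B_def)
    also have "\<dots> \<le> exp (12 * x * ln x) * exp (11 * x * ln x)"
    proof (rule mult_mono)
      have l3: "ln 3 \<le> 2 * ln x"
      proof -
        have "(2::real)\<^sup>2 \<le> x\<^sup>2" using x by (intro power_mono) auto
        then have "ln 3 \<le> ln (x\<^sup>2)" using x by (subst ln_le_cancel_iff) auto
        then show ?thesis using x by (simp add: ln_realpow)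
      qed
      have "3 ^ (k + 2) = exp (real (k + 2) * ln 3)"
        by (simp only: exp_of_nat_mult) simp
      also have "real (k + 2) * ln 3 \<le> (6 * x) * (2 * ln x)"
        using k x l3 by (intro mult_mono) auto
      finally show "3 ^ (k + 2) \<le> exp (12 * x * ln x)" by (simp add: mult_ac)
      have "16 * real k * (real H)\<^sup>2 \<le> 16 * (5 * x) * (33 * x\<^sup>2)\<^sup>2"
        using k H x by (intro mult_mono power_mono) auto
      also have "\<dots> = 87120 * x ^ 5"
        by (simp add: power2_eq_square power_def)
      also have "\<dots> \<le> x ^ 17 * x ^ 5"
      proof (rule mult_right_mono)
        have "(87120::real) \<le> 2 ^ 17" by simp
        also have "\<dots> \<le> x ^ 17" using x by (intro power_mono) auto
        finally show "87120 \<le> x ^ 17" .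
      qed (use x in simp)
      also have "\<dots> = x ^ 22" by (simp flip: power_add)
      also have "\<dots> = exp (real 22 * ln x)"
        using x by (simp only: exp_of_nat_mult) simp
      also have "\<dots> \<le> exp (11 * x * ln x)"
        using x by (simp add: mult_right_mono)
      finally show "16 * real k * (real H)\<^sup>2 \<le> exp (11 * x * ln x)" .
    qed auto
    also have "\<dots> = exp (23 * x * ln x)"
      by (simp add: algebra_simps flip: exp_add)
    finally show ?thesis by simp
  qed
  finally show ?thesis .
qed

section \<open>The theorem\<close>

text \<open>
  As \<open>\<epsilon>\<close> approaches 1 the lower bound on \<open>N\<close> shrinks to \<open>exp 1\<close>, so no asymptotic argument is
  available there. Instead, either \<open>A\<close> has density at most \<open>2 / 3\<close> and the right-hand side is
  negative, or \<open>A\<close> is so dense that by inclusion-exclusion it meets its translate by 1 often enough.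
\<close>

lemma popular_unit_difference:
  fixes A :: "int set" and \<epsilon> :: real
  assumes A: "A \<subseteq> {1..int N}" and N: "N \<ge> 3" and \<epsilon>: "\<epsilon> > 1 / 2"
  shows "real (card (A \<inter> translate A 1)) / real N > (real (card A) / real N)\<^sup>2 - \<epsilon>"
proof -
  define \<alpha> where "\<alpha> = real (card A) / real N"
  have fin: "finite A" using A finite_subset by auto
  have tr: "translate A 1 = (\<lambda>a. a + 1) ` A" by (auto simp: translate_def)
  have "card (translate A 1) = card A"
    unfolding tr by (rule card_image) (simp add: inj_on_def)
  then have "card A + card A = card (A \<union> translate A 1) + card (A \<inter> translate A 1)"
    using fin card_Un_Int[of A "translate A 1"] by (simp add: tr)
  moreover have "card (A \<union> translate A 1) \<le> card {1..int N + 1}"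
    using A by (intro card_mono) (auto simp: tr)
  ultimately have "2 * real (card A) - real N - 1 \<le> real (card (A \<inter> translate A 1))"
    by simp
  then have "(2 * real (card A) - real N - 1) / real N \<le> real (card (A \<inter> translate A 1)) / real N"
    by (rule divide_right_mono) simp
  then have lower: "2 * \<alpha> - 1 - 1 / real N \<le> real (card (A \<inter> translate A 1)) / real N"
    using N by (simp add: \<alpha>_def diff_divide_distrib)
  have invN: "1 / real N \<le> 1 / 3" using N by (intro divide_left_mono) auto
  have "card A \<le> card {1..int N}" using A by (intro card_mono) auto
  then have \<alpha>: "0 \<le> \<alpha>" "\<alpha> \<le> 1" using N by (auto simp: \<alpha>_def)
  have "real (card (A \<inter> translate A 1)) / real N > \<alpha>\<^sup>2 - \<epsilon>"
  proof (cases "\<alpha> \<le> 2 / 3")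
    case True
    then have "\<alpha>\<^sup>2 \<le> (2 / 3)\<^sup>2" using \<alpha> by (intro power_mono) auto
    then have "\<alpha>\<^sup>2 < \<epsilon>" using \<epsilon> by (simp add: power2_eq_square)
    then show ?thesis by (smt (verit) divide_nonneg_nonneg of_nat_0_le_iff)
  next
    case False
    then have "(1 - \<alpha>)\<^sup>2 \<le> (1 / 3)\<^sup>2" using \<alpha> by (intro power_mono) auto
    then have "\<alpha>\<^sup>2 - 2 * \<alpha> + 1 \<le> 1 / 9" by (simp add: power2_eq_square algebra_simps)
    then show ?thesis using lower invN \<epsilon> by linarith
  qed
  then show ?thesis by (simp add: \<alpha>_def)
qed

theorem theorem2:
  shows "\<exists>C::real. C > 0 \<and>
    (\<forall>(\<epsilon>::real) (N::nat) (A::int set).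
      \<epsilon> > 0 \<longrightarrow> N > 0 \<longrightarrow>
      real N \<ge> exp (exp (C * inverse \<epsilon> * ln (inverse \<epsilon>))) \<longrightarrow>
      A \<subseteq> {1..int N} \<longrightarrow>
      (\<exists>t::int. t \<noteq> 0 \<and>
        real (card (A \<inter> translate A (t ^ 2))) / real N
          > (real (card A) / real N) ^ 2 - \<epsilon>))"
proof (intro exI[of _ "23::real"] conjI allI impI)
  fix \<epsilon> :: real and N :: nat and A :: "int set"
  assume \<epsilon>: "\<epsilon> > 0" and N0: "N > 0"
    and N: "real N \<ge> exp (exp (23 * inverse \<epsilon> * ln (inverse \<epsilon>)))"
    and A: "A \<subseteq> {1..int N}"
  define \<alpha> where "\<alpha> = real (card A) / real N"
  have "card A \<le> card {1..int N}" using A by (intro card_mono) auto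
  then have \<alpha>: "0 \<le> \<alpha>" "\<alpha> \<le> 1" using N0 by (auto simp: \<alpha>_def)
  consider "\<epsilon> > 1" | "1 / 2 < \<epsilon>" "\<epsilon> \<le> 1" | "\<epsilon> \<le> 1 / 2" by linarith
  then show "\<exists>t::int. t \<noteq> 0 \<and>
      real (card (A \<inter> translate A (t ^ 2))) / real N > (real (card A) / real N) ^ 2 - \<epsilon>"
  proof cases
    case 1
    moreover have "\<alpha>\<^sup>2 \<le> 1" using \<alpha> by (simp add: power_le_one)
    ultimately have "\<alpha>\<^sup>2 - \<epsilon> < 0" by simp
    then have "(real (card A) / real N) ^ 2 - \<epsilon> < real (card (A \<inter> translate A (1 ^ 2))) / real N"
      unfolding \<alpha>_def by (rule less_le_trans) simp
    then show ?thesis by (intro exI[of _ 1]) simp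
  next
    case 2
    have "ln (inverse \<epsilon>) \<ge> 0"
      using 2 \<epsilon> by (simp add: ln_ge_zero one_le_inverse)
    then have "exp (23 * inverse \<epsilon> * ln (inverse \<epsilon>)) \<ge> 1" using \<epsilon> by simp
    then have "exp (exp (23 * inverse \<epsilon> * ln (inverse \<epsilon>))) \<ge> exp 1" by simp
    moreover have "exp (1::real) \<ge> (1 + 1 / 2) ^ 2"
      using exp_ge_one_plus_x_over_n_power_n[of 2 1] by simp
    moreover have "(1 + 1 / 2 :: real) ^ 2 > 2" by (simp add: power2_eq_square)
    ultimately have "N \<ge> 3" using N by linarith
    then show ?thesis
      using popular_unit_difference[OF A _ 2(1)] by (intro exI[of _ 1]) simp
  next
    case 3
    \<comment> \<open>\<open>H\<close> and \<open>k\<close> are chosen to make each of \<open>sqrt (2 / H)\<close> and \<open>1 / k\<close> at most \<open>\<epsilon> / 4\<close>.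
      The other \<open>\<epsilon> / 2\<close> pays for enlarging the modulus from \<open>N\<close> to \<open>N + T\<^sup>2\<close>.\<close>
    define x where "x = inverse \<epsilon>"
    define H where "H = nat \<lceil>32 * x\<^sup>2\<rceil>"
    define k where "k = nat \<lceil>4 * x\<rceil>"
    define T where "T = (8 * H * fact (2 * H) ^ (2 * k)) ^ (3 ^ k + 2)"
    have x: "x \<ge> 2" using 3 \<epsilon> by (simp add: x_def field_simps)
    have \<epsilon>x: "\<epsilon> = 1 / x" by (simp add: x_def inverse_eq_divide)
    have "1 \<le> x\<^sup>2" using x by simp
    then have H: "32 * x\<^sup>2 \<le> H" "H \<le> 33 * x\<^sup>2"
      unfolding H_def by linarith+
    have k: "4 * x \<le> k" "k \<le> 4 * x + 1" using x unfolding k_def by linarith+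
    have pos: "H > 0" "k > 0" using H(1) k(1) x \<open>1 \<le> x\<^sup>2\<close> by linarith+
    have "2 * x * (real T)\<^sup>2 < exp (exp (23 * x * ln x))"
      unfolding T_def using x H k by (intro shift_bound_less_exp_exp) auto
    also have "\<dots> \<le> real N" using N by (simp add: x_def)
    finally have TN: "(real T)\<^sup>2 / real N < \<epsilon> / 2"
      using x N0 by (simp add: \<epsilon>x field_simps)
    obtain t :: int where t: "t \<noteq> 0" "real (card (A \<inter> translate A (t\<^sup>2)))
        \<ge> (real (card A))\<^sup>2 / real (N + T\<^sup>2) - (1 / real k + sqrt (2 / real H)) * real (card A)"
      using popular_square_difference[OF A N0 pos] unfolding T_def by blast
    have "1 / real k \<le> 1 / (4 * x)" using k x by (intro divide_left_mono) auto
    moreover have "sqrt (2 / real H) \<le> 1 / (4 * x)"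
    proof (rule real_le_lsqrt[THEN order_trans[OF _ order_refl]])
      have "2 / real H \<le> 2 / (32 * x\<^sup>2)" using H(1) x by (intro divide_left_mono) (auto intro: mult_pos_pos simp: pos)
      then show "2 / real H \<le> (1 / (4 * x))\<^sup>2" by (simp add: power2_eq_square)
    qed (use x in auto)
    ultimately have \<eta>: "1 / real k + sqrt (2 / real H) \<le> \<epsilon> / 2" by (simp add: \<epsilon>x)
    have "\<alpha>\<^sup>2 - \<epsilon> < \<alpha>\<^sup>2 * (1 - (real T)\<^sup>2 / real N) - \<epsilon> / 2 * \<alpha>"
    proof -
      have "\<alpha>\<^sup>2 * ((real T)\<^sup>2 / real N) \<le> 1 * ((real T)\<^sup>2 / real N)"
        using \<alpha> by (intro mult_right_mono) (auto simp: power_le_one)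
      moreover have "\<epsilon> / 2 * \<alpha> \<le> \<epsilon> / 2 * 1" using \<alpha> \<epsilon> by (intro mult_left_mono) auto
      ultimately show ?thesis using TN unfolding right_diff_distrib by linarith
    qed
    also have "\<dots> \<le> \<alpha>\<^sup>2 * (real N / real (N + T\<^sup>2)) - (1 / real k + sqrt (2 / real H)) * \<alpha>"
    proof (intro diff_mono mult_left_mono mult_right_mono \<eta>)
      have "(1 - (real T)\<^sup>2 / real N) * real (N + T\<^sup>2) = real N - (real T)\<^sup>2 * ((real T)\<^sup>2 / real N)"
        using N0 by (simp add: field_simps power2_eq_square)
      also have "\<dots> \<le> real N" by simp
      finally show "1 - (real T)\<^sup>2 / real N \<le> real N / real (N + T\<^sup>2)"
        using N0 by (subst pos_le_divide_eq) (simp_all add: add_pos_nonneg)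
    qed (use \<alpha> in auto)
    also have "\<dots> = ((real (card A))\<^sup>2 / real (N + T\<^sup>2)
        - (1 / real k + sqrt (2 / real H)) * real (card A)) / real N"
      using N0 by (simp add: \<alpha>_def diff_divide_distrib power2_eq_square)
    also have "\<dots> \<le> real (card (A \<inter> translate A (t\<^sup>2))) / real N"
      using t(2) by (rule divide_right_mono) simp
    finally show ?thesis using t(1) by (auto simp: \<alpha>_def)
  qed
qed simp

end
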